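(* Assume that $f$ is constant. Let $c(\lambda)=c_{(1+\lambda)\Omega}$ for $\lambda\in(-\varepsilon_0,\varepsilon_0)$. Then $\lambda\mapsto c(\lambda)$ belongs to $C^\infty$ in its domain $(-\varepsilon_0,\varepsilon_0)$.
   Context: Standing assumptions. $\varepsilon>0$ is fixed, $p>2$, $U\subset\mathbb{R}^n$ is open and bounded with smooth boundary, $f\in C^1(\overline U)$, and $H(x,\xi)=|\xi|^p-f(x)$. $\Omega\subset\mathbb{R}^n$ is open, bounded, connected, with $C^2$ boundary, $\overline\Omega\subset U$, star-shaped with respect to the origin, and there is $\kappa>0$ such that $\overline{B(0,\kappa)}\subset\Omega$ and $\mathrm{dist}(x,\overline\Omega)\ge\kappa s$ for all $x\in(1+s)\partial\Omega$ and all $s>0$. The number $\varepsilon_0\in(0,1)$ is such that $(1+\lambda)\Omega\subset U$ for $|\lambda|<\varepsilon_0$. Viscosity subsolutions. For an open set $\mathcal{O}$ and $c\in\mathbb{R}$, $w$ satisfies $H(x,Dw)-\varepsilon\Delta w\le c$ in $\mathcal{O}$ if for every $x\in\mathcal{O}$ and $\varphi\in C^2(\mathcal{O})$ such that $w-\varphi$ has a local maximum at $x$, $H(x,D\varphi(x))-\varepsilon\Delta\varphi(x)\le c$. Additive eigenvalue. $c_{\mathcal{O}}=\min\{c\in\mathbb{R}: H(x,Du)-\varepsilon\Delta u\le c\text{ in }\mathcal{O}\text{ has a (continuous viscosity) solution}\}$. *)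

theory Defs
  imports "HOL-Analysis.Analysis" "HOL-Library.Extended_Nat"
begin

(* Functions are total in HOL, so f :: 'a => real stands for a function on an open set S
   through its values on S; the derivatives below only depend on those values. *)

definition partial_deriv :: "'a::euclidean_space \<Rightarrow> ('a \<Rightarrow> real) \<Rightarrow> 'a \<Rightarrow> real" where
  "partial_deriv b f x = frechet_derivative f (at x) b"

definition gradient :: "('a::euclidean_space \<Rightarrow> real) \<Rightarrow> 'a \<Rightarrow> 'a" where
  "gradient f x = (\<Sum>b\<in>Basis. partial_deriv b f x *\<^sub>R b)"

definition laplacian :: "('a::euclidean_space \<Rightarrow> real) \<Rightarrow> 'a \<Rightarrow> real" where
  "laplacian f x = (\<Sum>b\<in>Basis. partial_deriv b (partial_deriv b f) x)"

(* C^k on an open set S, for finite k *)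
primrec Ck_on :: "nat \<Rightarrow> ('a::euclidean_space \<Rightarrow> real) \<Rightarrow> 'a set \<Rightarrow> bool" where
  "Ck_on 0 f S \<longleftrightarrow> continuous_on S f"
| "Ck_on (Suc k) f S \<longleftrightarrow>
     (\<forall>x\<in>S. f differentiable (at x)) \<and> (\<forall>b\<in>Basis. Ck_on k (partial_deriv b f) S)"

(* C^k on an open set S, where k may be \<infinity> *)
definition C_on :: "enat \<Rightarrow> ('a::euclidean_space \<Rightarrow> real) \<Rightarrow> 'a set \<Rightarrow> bool" where
  "C_on k f S \<longleftrightarrow> (\<forall>m::nat. enat m \<le> k \<longrightarrow> Ck_on m f S)"

(* f in C^1(closure U), for U open: f is C^1 in U, and f and its first partial derivatives
   extend continuously to the closure (the extension of f being f itself). *)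
definition C1_on_closure :: "('a::euclidean_space \<Rightarrow> real) \<Rightarrow> 'a set \<Rightarrow> bool" where
  "C1_on_closure f U \<longleftrightarrow>
     C_on 1 f U \<and> continuous_on (closure U) f \<and>
     (\<forall>b\<in>Basis. \<exists>g. continuous_on (closure U) g \<and> (\<forall>x\<in>U. g x = partial_deriv b f x))"

(* Near each boundary point, S is the part of a ball lying strictly above the graph of a C^k
   function over a hyperplane, in the direction of a unit normal e of that hyperplane.
   x - (x \<bullet> e) *\<^sub>R e is the orthogonal projection of x to the hyperplane;
   only the values of \<gamma> there matter. *)
definition has_C_boundary :: "enat \<Rightarrow> 'a::euclidean_space set \<Rightarrow> bool" where
  "has_C_boundary k S \<longleftrightarrow>
     (\<forall>x0\<in>frontier S. \<exists>r>0. \<exists>e \<gamma>. norm e = 1 \<and> C_on k \<gamma> UNIV \<and>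
        S \<inter> ball x0 r = {x \<in> ball x0 r. x \<bullet> e > \<gamma> (x - (x \<bullet> e) *\<^sub>R e)})"

definition star_shaped_about :: "'a::euclidean_space \<Rightarrow> 'a set \<Rightarrow> bool" where
  "star_shaped_about a S \<longleftrightarrow> a \<in> S \<and> (\<forall>x\<in>S. closed_segment a x \<subseteq> S)"

abbreviation dilate :: "real \<Rightarrow> 'a::euclidean_space set \<Rightarrow> 'a set" where
  "dilate r S \<equiv> (\<lambda>x. r *\<^sub>R x) ` S"

definition hamiltonian :: "real \<Rightarrow> ('a::euclidean_space \<Rightarrow> real) \<Rightarrow> 'a \<Rightarrow> 'a \<Rightarrow> real" where
  "hamiltonian p f x \<xi> = norm \<xi> powr p - f x"

(* w satisfies H(x,Dw) - \<epsilon> \<Delta>w \<le> c in the open set S in the viscosity sense *)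
definition viscosity_subsolution ::
  "real \<Rightarrow> ('a::euclidean_space \<Rightarrow> 'a \<Rightarrow> real) \<Rightarrow> 'a set \<Rightarrow> real \<Rightarrow> ('a \<Rightarrow> real) \<Rightarrow> bool" where
  "viscosity_subsolution \<epsilon> H S c w \<longleftrightarrow>
     (\<forall>x\<in>S. \<forall>\<phi>. C_on 2 \<phi> S \<and>
        (\<exists>r>0. \<forall>y\<in>S \<inter> ball x r. w y - \<phi> y \<le> w x - \<phi> x) \<longrightarrow>
        H x (gradient \<phi> x) - \<epsilon> * laplacian \<phi> x \<le> c)"

(* LEAST renders "min": it denotes the minimum of the set of admissible c, and is unspecified
   if there is no minimum. *)
definition additive_eigenvalue ::
  "real \<Rightarrow> ('a::euclidean_space \<Rightarrow> 'a \<Rightarrow> real) \<Rightarrow> 'a set \<Rightarrow> real" where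
  "additive_eigenvalue \<epsilon> H S =
     (LEAST c. \<exists>u. continuous_on S u \<and> viscosity_subsolution \<epsilon> H S c u)"

end

(* For constant f, the rescaling u \<mapsto> r^(2-q) u(x / r) with q = p / (p - 1) turns |Du|^p and \<Delta>u
   homogeneous of the same degree -q, so it maps subsolutions on S at level c to subsolutions on
   r S at level r^(-q) (c + f) - f. Hence c(t) is an affine function of (1 + t)^(-q). Existence of the
   minimum defining the eigenvalue is not at stake: it exists on all dilates or on none, and in
   the latter case the unspecified value of LEAST does not depend on t. *)
theory Submission
  imports Defs
begin

section \<open>Derivatives on open sets and under dilations of the argument\<close>

lemma partial_deriv_cong_open:
  assumes "open S" "x \<in> S" "\<And>y. y \<in> S \<Longrightarrow> f y = g y"
  shows "partial_deriv b f x = partial_deriv b g x"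
proof -
  \<comment> \<open>The equivalence holds for every candidate \<open>D\<close>, so the choice
    operator inside \<open>frechet_derivative\<close> returns the same map for \<open>f\<close> and
    \<open>g\<close>, even at points where neither is differentiable.\<close>
  have "(f has_derivative D) (at x) \<longleftrightarrow> (g has_derivative D) (at x)" for D
    using assms has_derivative_transform_within_open[of f D x UNIV S g]
      has_derivative_transform_within_open[of g D x UNIV S f] by auto
  then show ?thesis
    by (simp add: partial_deriv_def frechet_derivative_def)
qed

lemma Ck_on_cong_open:
  assumes "open S" "\<And>y. y \<in> S \<Longrightarrow> f y = g y"
  shows "Ck_on k f S \<longleftrightarrow> Ck_on k g S"
  using assms(2)
proof (induction k arbitrary: f g)
  case 0
  then show ?case by (simp cong: continuous_on_cong)
next
  case (Suc k)
  have "f differentiable at x \<longleftrightarrow> g differentiable at x" if "x \<in> S" for x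
    using that assms(1) Suc.prems has_derivative_transform_within_open[of f _ x UNIV S g]
      has_derivative_transform_within_open[of g _ x UNIV S f]
    unfolding differentiable_def by metis
  moreover have "Ck_on k (partial_deriv b f) S \<longleftrightarrow> Ck_on k (partial_deriv b g) S" for b
    using partial_deriv_cong_open[OF assms(1)] Suc.prems by (intro Suc.IH) blast
  ultimately show ?case by simp
qed

lemma has_derivative_scale:
  fixes \<phi> :: "'a::euclidean_space \<Rightarrow> real"
  assumes "\<phi> differentiable at (r *\<^sub>R y)"
  shows "((\<lambda>y. a * \<phi> (r *\<^sub>R y)) has_derivative
    (\<lambda>h. a * r * frechet_derivative \<phi> (at (r *\<^sub>R y)) h)) (at y)"
proof -
  let ?D = "frechet_derivative \<phi> (at (r *\<^sub>R y))"
  have D: "(\<phi> has_derivative ?D) (at (r *\<^sub>R y))"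
    using assms by (simp add: frechet_derivative_works)
  have "((\<lambda>y. \<phi> (r *\<^sub>R y)) has_derivative (\<lambda>h. ?D (r *\<^sub>R h))) (at y)"
    by (rule has_derivative_compose[of "\<lambda>y. r *\<^sub>R y" "\<lambda>h. r *\<^sub>R h" y UNIV \<phi>, OF _ D])
      (auto intro!: derivative_eq_intros)
  then have "((\<lambda>y. a * \<phi> (r *\<^sub>R y)) has_derivative (\<lambda>h. a * ?D (r *\<^sub>R h))) (at y)"
    by (rule has_derivative_mult_right)
  moreover have "?D (r *\<^sub>R h) = r * ?D h" for h
    using linear_cmul[OF linear_frechet_derivative[OF assms], of r h] by simp
  ultimately show ?thesis by (simp add: mult.assoc)
qed

lemma partial_deriv_scale:
  fixes \<phi> :: "'a::euclidean_space \<Rightarrow> real"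
  assumes "\<phi> differentiable at (r *\<^sub>R y)"
  shows "partial_deriv b (\<lambda>y. a * \<phi> (r *\<^sub>R y)) y = a * r * partial_deriv b \<phi> (r *\<^sub>R y)"
  unfolding partial_deriv_def
  using frechet_derivative_at[OF has_derivative_scale[OF assms, of a], symmetric] by simp

text \<open>Functions of the form \<open>a * \<phi> (r *\<^sub>R y)\<close> are closed under partial
  differentiation: \<open>a\<close> becomes \<open>a * r\<close> and \<open>\<phi>\<close> becomes
  its partial derivative. The free factor \<open>a\<close> is what lets the induction on
  \<open>k\<close> close.\<close>

lemma Ck_on_scale:
  fixes \<phi> :: "'a::euclidean_space \<Rightarrow> real"
  assumes "open S" "Ck_on k \<phi> (dilate r S)"
  shows "Ck_on k (\<lambda>y. a * \<phi> (r *\<^sub>R y)) S"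
  using assms(2)
proof (induction k arbitrary: a \<phi>)
  case 0
  then show ?case
    by (auto intro!: continuous_intros continuous_on_compose2[of "dilate r S" \<phi>])
next
  case (Suc k)
  have diff: "\<phi> differentiable at (r *\<^sub>R y)" if "y \<in> S" for y
    using Suc.prems that by auto
  have "Ck_on k (partial_deriv b (\<lambda>y. a * \<phi> (r *\<^sub>R y))) S" if "b \<in> Basis" for b
  proof -
    have "Ck_on k (\<lambda>y. a * r * partial_deriv b \<phi> (r *\<^sub>R y)) S"
      using Suc.prems that by (intro Suc.IH) simp
    then show ?thesis
      by (subst Ck_on_cong_open[OF assms(1) partial_deriv_scale[OF diff]])
  qed
  moreover have "(\<lambda>y. a * \<phi> (r *\<^sub>R y)) differentiable at y" if "y \<in> S" for y
    using has_derivative_scale[OF diff[OF that]] by (rule differentiableI)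
  ultimately show ?case by simp
qed

section \<open>Subsolutions and their levels under dilation\<close>

lemma viscosity_subsolution_dilate:
  fixes S :: "'a::euclidean_space set" and k :: real
  assumes "r > 0" "p > 1" "open S"
    and fS: "\<And>x. x \<in> S \<Longrightarrow> f x = k" and gS: "\<And>x. x \<in> dilate r S \<Longrightarrow> g x = k"
    and w: "viscosity_subsolution \<epsilon> (hamiltonian p f) S c w"
  defines "q \<equiv> p / (p - 1)"
  shows "viscosity_subsolution \<epsilon> (hamiltonian p g) (dilate r S) (r powr (- q) * (c + k) - k)
    (\<lambda>x. r powr (2 - q) * w (inverse r *\<^sub>R x))"
  unfolding viscosity_subsolution_def
proof (intro ballI allI impI)
  fix x \<phi>
  let ?W = "\<lambda>x. r powr (2 - q) * w (inverse r *\<^sub>R x)"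
  assume x: "x \<in> dilate r S" and H: "C_on 2 \<phi> (dilate r S) \<and>
    (\<exists>\<rho>>0. \<forall>z\<in>dilate r S \<inter> ball x \<rho>. ?W z - \<phi> z \<le> ?W x - \<phi> x)"
  obtain y where y: "y \<in> S" "x = r *\<^sub>R y" using x by blast
  obtain \<rho> where \<rho>: "\<rho> > 0" "\<And>z. z \<in> dilate r S \<Longrightarrow> z \<in> ball x \<rho> \<Longrightarrow> ?W z - \<phi> z \<le> ?W x - \<phi> x"
    using H by blast
  have C: "Ck_on m \<phi> (dilate r S)" if "m \<le> 2" for m
    using H that by (simp add: C_on_def numeral_eq_enat)
  \<comment> \<open>The factor \<open>a\<close> inverts the weight \<open>r powr (2 - q)\<close> of
    the rescaled function. With \<open>\<psi>\<close> the pullback of the test function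
    \<open>\<phi>\<close>, the difference \<open>w - \<psi>\<close> at \<open>z\<close> is
    \<open>a\<close> times \<open>?W - \<phi>\<close> at \<open>r *\<^sub>R z\<close>, so local
    maxima correspond.\<close>
  define a where "a = r powr (q - 2)"
  define \<psi> where "\<psi> = (\<lambda>y. a * \<phi> (r *\<^sub>R y))"
  \<comment> \<open>The third identity gives the scaling of the gradient of \<open>\<psi>\<close>,
    the fourth that of its Laplacian.\<close>
  have a: "a > 0" "a * r powr (2 - q) = 1" "a * r = r powr (q - 1)" "a * r * r = r powr q"
    using \<open>r > 0\<close> by (simp_all add: a_def powr_diff powr_add field_simps power2_eq_square)
  have "C_on 2 \<psi> S"
    unfolding C_on_def \<psi>_def using C Ck_on_scale[OF \<open>open S\<close>] by (simp add: numeral_eq_enat)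
  moreover have "\<exists>\<rho>>0. \<forall>z\<in>S \<inter> ball y \<rho>. w z - \<psi> z \<le> w y - \<psi> y"
  \<comment> \<open>Dilation by \<open>r\<close> takes the ball of radius \<open>\<rho> / r\<close>
    about \<open>y\<close> into the ball of radius \<open>\<rho>\<close> about
    \<open>x\<close>.\<close>
  proof (intro exI[of _ "\<rho> / r"] conjI ballI)
    show "\<rho> / r > 0" using \<rho> \<open>r > 0\<close> by simp
    fix z assume z: "z \<in> S \<inter> ball y (\<rho> / r)"
    have "dist x (r *\<^sub>R z) = r * dist y z"
      using \<open>r > 0\<close> by (simp add: y(2) dist_norm flip: scaleR_diff_right)
    then have "r *\<^sub>R z \<in> ball x \<rho>"
      using z \<open>r > 0\<close> by (simp add: field_simps)
    then have "?W (r *\<^sub>R z) - \<phi> (r *\<^sub>R z) \<le> ?W x - \<phi> x"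
      using z by (intro \<rho>(2)) auto
    then have "a * (?W (r *\<^sub>R z) - \<phi> (r *\<^sub>R z)) \<le> a * (?W x - \<phi> x)"
      using a(1) by simp
    then show "w z - \<psi> z \<le> w y - \<psi> y"
      using \<open>r > 0\<close> a(2) by (simp add: \<psi>_def y(2) right_diff_distrib flip: mult.assoc)
  qed
  ultimately have *: "hamiltonian p f y (gradient \<psi> y) - \<epsilon> * laplacian \<psi> y \<le> c"
    using w y(1) unfolding viscosity_subsolution_def by blast
  have d1: "\<phi> differentiable at (r *\<^sub>R z)" if "z \<in> S" for z
    using C[of "Suc 0"] that by auto
  have d2: "partial_deriv b \<phi> differentiable at (r *\<^sub>R z)" if "z \<in> S" "b \<in> Basis" for z b
    using C[of "Suc (Suc 0)"] that by auto
  have "gradient \<psi> y = (a * r) *\<^sub>R gradient \<phi> x"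
    by (simp add: gradient_def \<psi>_def partial_deriv_scale d1 y scaleR_sum_right)
  then have "norm (gradient \<psi> y) powr p = r powr ((q - 1) * p) * norm (gradient \<phi> x) powr p"
    using a(3) by (simp add: powr_mult powr_powr)
  \<comment> \<open>This is where the conjugate exponent enters: the gradient term acquires the
    factor \<open>r powr q\<close>, the same as the Laplacian.\<close>
  moreover have "(q - 1) * p = q"
    using \<open>p > 1\<close> by (simp add: q_def field_simps)
  moreover have "laplacian \<psi> y = r powr q * laplacian \<phi> x"
  proof -
    have "partial_deriv b (partial_deriv b \<psi>) y = r powr q * partial_deriv b (partial_deriv b \<phi>) x"
      if b: "b \<in> Basis" for b
    proof -
      \<comment> \<open>The formula for the first derivative holds on all of the open set
        \<open>S\<close>, not only at \<open>y\<close>, and may therefore be differentiated once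
        more.\<close>
      have "partial_deriv b (partial_deriv b \<psi>) y
          = partial_deriv b (\<lambda>z. (a * r) * partial_deriv b \<phi> (r *\<^sub>R z)) y"
        by (rule partial_deriv_cong_open[OF \<open>open S\<close> y(1)]) (simp add: \<psi>_def partial_deriv_scale d1)
      also have "\<dots> = r powr q * partial_deriv b (partial_deriv b \<phi>) x"
        using partial_deriv_scale[OF d2[OF y(1) b], of b "a * r"] a(4) y(2) by simp
      finally show ?thesis .
    qed
    then show ?thesis by (simp add: laplacian_def sum_distrib_left)
  qed
  ultimately have "r powr q * (norm (gradient \<phi> x) powr p - \<epsilon> * laplacian \<phi> x) \<le> c + k"
    using * fS[OF y(1)] by (simp add: hamiltonian_def algebra_simps)
  then have "norm (gradient \<phi> x) powr p - \<epsilon> * laplacian \<phi> x \<le> r powr (- q) * (c + k)"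
    using \<open>r > 0\<close> by (simp add: powr_minus field_simps)
  then show "hamiltonian p g x (gradient \<phi> x) - \<epsilon> * laplacian \<phi> x \<le> r powr (- q) * (c + k) - k"
    using gS[OF x] by (simp add: hamiltonian_def)
qed

lemma subsolution_level_dilate:
  fixes S :: "'a::euclidean_space set" and k :: real
  assumes "r > 0" "p > 1" "open S"
    and "\<And>x. x \<in> S \<Longrightarrow> f x = k" "\<And>x. x \<in> dilate r S \<Longrightarrow> g x = k"
    and "\<exists>u. continuous_on S u \<and> viscosity_subsolution \<epsilon> (hamiltonian p f) S c u"
  shows "\<exists>u. continuous_on (dilate r S) u \<and> viscosity_subsolution \<epsilon> (hamiltonian p g)
    (dilate r S) (r powr (- (p / (p - 1))) * (c + k) - k) u"
proof -
  obtain u where u: "continuous_on S u" "viscosity_subsolution \<epsilon> (hamiltonian p f) S c u"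
    using assms(6) by blast
  have "continuous_on (dilate r S) (\<lambda>x. r powr (2 - p / (p - 1)) * u (inverse r *\<^sub>R x))"
    using \<open>r > 0\<close> by (intro continuous_intros continuous_on_compose2[OF u(1)]) auto
  then show ?thesis
    using viscosity_subsolution_dilate[OF assms(1-5) u(2)] by (intro exI conjI)
qed

text \<open>The converse is the forward direction applied to \<open>dilate r S\<close> with factor
  \<open>inverse r\<close>: this dilation restores \<open>S\<close>, and its map on levels inverts
  the one for \<open>r\<close>.\<close>

lemma subsolution_level_dilate_iff:
  fixes S :: "'a::euclidean_space set" and k :: real
  assumes "r > 0" "p > 1" "open S"
    and f: "\<And>x. x \<in> S \<Longrightarrow> f x = k" "\<And>x. x \<in> dilate r S \<Longrightarrow> f x = k"
  shows "(\<exists>u. continuous_on (dilate r S) u \<and> viscosity_subsolution \<epsilon> (hamiltonian p f)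
      (dilate r S) (r powr (- (p / (p - 1))) * (c + k) - k) u)
    \<longleftrightarrow> (\<exists>u. continuous_on S u \<and> viscosity_subsolution \<epsilon> (hamiltonian p f) S c u)"
    (is "?L \<longleftrightarrow> ?R")
proof
  have inv: "dilate (inverse r) (dilate r S) = S"
    using \<open>r > 0\<close> by (simp add: image_image)
  have o: "open (dilate r S)"
    using \<open>r > 0\<close> \<open>open S\<close> by (simp add: open_scaling)
  have "inverse r powr (- (p / (p - 1))) * (r powr (- (p / (p - 1))) * (c + k) - k + k) - k = c"
    using \<open>r > 0\<close> by (simp add: powr_minus inverse_powr flip: mult.assoc)
  moreover assume ?L
  ultimately show ?R
    using subsolution_level_dilate[of "inverse r" p "dilate r S" f k f] o assms inv
    by (metis (no_types, lifting) inverse_positive_iff_positive)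
qed (use assms in \<open>intro subsolution_level_dilate[of r p S f k f]; blast\<close>)

section \<open>The eigenvalue as a function of the dilation factor\<close>

text \<open>The map \<open>g r\<close> on levels is an increasing bijection of the reals that
  carries the admissible levels of \<open>S\<close> onto those of \<open>dilate r S\<close>, hence a
  minimum to a minimum. The constants \<open>A\<close> and \<open>B\<close> are fixed before
  \<open>r\<close>, so one formula serves all dilates.\<close>

lemma additive_eigenvalue_dilate:
  fixes S :: "'a::euclidean_space set" and k :: real
  assumes "p > 1" "open S" "\<And>x. x \<in> S \<Longrightarrow> f x = k"
  obtains A B where "\<And>r. r > 0 \<Longrightarrow> (\<And>x. x \<in> dilate r S \<Longrightarrow> f x = k) \<Longrightarrow>
    additive_eigenvalue \<epsilon> (hamiltonian p f) (dilate r S) = A + B * r powr (- (p / (p - 1)))"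
proof -
  define P where "P T c \<longleftrightarrow>
    (\<exists>u. continuous_on T u \<and> viscosity_subsolution \<epsilon> (hamiltonian p f) T c u)" for T c
  define g where "g r c = r powr (- (p / (p - 1))) * (c + k) - k" for r c
  have P_g: "P (dilate r S) (g r c) \<longleftrightarrow> P S c" if "r > 0" "\<And>x. x \<in> dilate r S \<Longrightarrow> f x = k" for r c
    unfolding P_def g_def using subsolution_level_dilate_iff[of r p S f k] that assms by blast
  \<comment> \<open>The witness solves \<open>d = g r c\<close> for \<open>c\<close>.\<close>
  have g_surj: "\<exists>c. d = g r c" if "r > 0" for r d
    using that by (intro exI[of _ "r powr (p / (p - 1)) * (d + k) - k"])
      (simp add: g_def powr_minus field_simps)
  have g_le: "g r c \<le> g r d \<longleftrightarrow> c \<le> d" if "r > 0" for r c d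
    using that by (simp add: g_def)
  have eig: "additive_eigenvalue \<epsilon> (hamiltonian p f) T = (LEAST c. P T c)" for T
    by (simp add: additive_eigenvalue_def P_def)
  show ?thesis
  \<comment> \<open>If \<open>S\<close> has a least admissible level \<open>m\<close>, then
    \<open>A = - k\<close> and \<open>B = m + k\<close>.\<close>
  proof (cases "\<exists>m. P S m \<and> (\<forall>c. P S c \<longrightarrow> m \<le> c)")
    case True
    then obtain m where m: "P S m" "\<And>c. P S c \<Longrightarrow> m \<le> c" by blast
    have "(LEAST c. P (dilate r S) c) = - k + (m + k) * r powr (- (p / (p - 1)))"
      if r: "r > 0" "\<And>x. x \<in> dilate r S \<Longrightarrow> f x = k" for r
    proof -
      have "(LEAST c. P (dilate r S) c) = g r m"
        using P_g[OF r] g_surj[OF r(1)] g_le[OF r(1)] m by (intro Least_equality) metis+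
      then show ?thesis by (simp add: g_def mult.commute)
    qed
    then show ?thesis using eig that by metis
  next
    case False
    \<comment> \<open>Without a minimum on \<open>S\<close> there is none on any dilate considered,
      so the predicate under the description operator in \<open>Least_def\<close> is identically
      false. The default value is then the same for all these \<open>r\<close>, and
      \<open>B = 0\<close> works.\<close>
    have "(LEAST c. P (dilate r S) c) = (THE c. False) + 0 * r powr (- (p / (p - 1)))"
      if r: "r > 0" "\<And>x. x \<in> dilate r S \<Longrightarrow> f x = k" for r
    proof -
      have "\<not> (P (dilate r S) d \<and> (\<forall>c. P (dilate r S) c \<longrightarrow> d \<le> c))" for d
        using False P_g[OF r] g_surj[OF r(1), of d] g_le[OF r(1)] by metis
      then show ?thesis by (simp only: Least_def mult_zero_left add_0_right)
    qed
    then show ?thesis using eig that by metis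
  qed
qed

section \<open>Smoothness of the resulting formula\<close>

text \<open>The family is closed under differentiation, with \<open>A\<close>, \<open>B\<close>,
  \<open>q\<close> replaced by \<open>0\<close>, \<open>B * q\<close>, \<open>q - 1\<close>;
  generalising over all three makes the induction work. Restricting to \<open>t > -1\<close> keeps
  the base of the power positive.\<close>

lemma Ck_on_affine_powr:
  fixes A B q :: real
  assumes "open S" "S \<subseteq> {-1<..}"
  shows "Ck_on k (\<lambda>t. A + B * (1 + t) powr q) S"
proof (induction k arbitrary: A B q)
  case 0
  show ?case using assms(2) by (auto intro!: continuous_intros)
next
  case (Suc k)
  have D: "((\<lambda>t. A + B * (1 + t) powr q) has_derivative (*) (B * q * (1 + t) powr (q - 1))) (at t)"
    if "t \<in> S" for t
  proof -
    have "1 + t > 0" using that assms(2) by auto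
    then have "((\<lambda>t. A + B * (1 + t) powr q) has_real_derivative B * q * (1 + t) powr (q - 1)) (at t)"
      by (auto intro!: derivative_eq_intros)
    then show ?thesis by (simp add: has_field_derivative_def)
  qed
  \<comment> \<open>The summand \<open>0\<close> puts the derivative in the shape of the induction
    hypothesis.\<close>
  have "Ck_on k (\<lambda>t. 0 + (B * q) * (1 + t) powr (q - 1)) S" by (rule Suc.IH)
  moreover have "partial_deriv 1 (\<lambda>t. A + B * (1 + t) powr q) t = 0 + (B * q) * (1 + t) powr (q - 1)"
    if "t \<in> S" for t
    unfolding partial_deriv_def using frechet_derivative_at[OF D[OF that], symmetric] by simp
  ultimately have "Ck_on k (partial_deriv 1 (\<lambda>t. A + B * (1 + t) powr q)) S"
    using Ck_on_cong_open[OF \<open>open S\<close>] by (metis (no_types, lifting))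
  then show ?case using D by (auto intro: differentiableI)
qed

theorem theorem1p5:
  fixes U \<Omega> :: "'a::euclidean_space set"
    and f :: "'a \<Rightarrow> real"
    and \<epsilon> \<epsilon>0 p :: real
    and c :: "real \<Rightarrow> real"
  assumes "\<epsilon> > 0" and "p > 2"
    and "open U" and "bounded U" and "has_C_boundary \<infinity> U"
    and "C1_on_closure f U"
    and "open \<Omega>" and "bounded \<Omega>" and "connected \<Omega>" and "has_C_boundary 2 \<Omega>"
    and "closure \<Omega> \<subseteq> U"
    and "star_shaped_about 0 \<Omega>"
    and "\<exists>\<kappa>>0. cball 0 \<kappa> \<subseteq> \<Omega> \<and>
           (\<forall>s>0. \<forall>x\<in>dilate (1 + s) (frontier \<Omega>). infdist x (closure \<Omega>) \<ge> \<kappa> * s)"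
    and "0 < \<epsilon>0" and "\<epsilon>0 < 1"
    and "\<And>t. \<bar>t\<bar> < \<epsilon>0 \<Longrightarrow> dilate (1 + t) \<Omega> \<subseteq> U"
    and "f constant_on closure U"
    and "\<And>t. t \<in> {-\<epsilon>0<..<\<epsilon>0} \<Longrightarrow>
           c t = additive_eigenvalue \<epsilon> (hamiltonian p f) (dilate (1 + t) \<Omega>)"
  shows "C_on \<infinity> c {-\<epsilon>0<..<\<epsilon>0}"
proof -
  obtain k where k: "\<And>x. x \<in> U \<Longrightarrow> f x = k"
    using \<open>f constant_on closure U\<close> closure_subset[of U] unfolding constant_on_def by blast
  have "\<Omega> \<subseteq> U" using \<open>closure \<Omega> \<subseteq> U\<close> closure_subset by blast
  then obtain A B where AB: "\<And>r. r > 0 \<Longrightarrow> (\<And>x. x \<in> dilate r \<Omega> \<Longrightarrow> f x = k) \<Longrightarrow>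
      additive_eigenvalue \<epsilon> (hamiltonian p f) (dilate r \<Omega>) = A + B * r powr (- (p / (p - 1)))"
    using \<open>p > 2\<close> \<open>open \<Omega>\<close> k by (elim additive_eigenvalue_dilate[of p \<Omega> f k \<epsilon>, rotated 3]) auto
  let ?I = "{-\<epsilon>0<..<\<epsilon>0}"
  have c_eq: "c t = A + B * (1 + t) powr (- (p / (p - 1)))" if t: "t \<in> ?I" for t
  proof -
    \<comment> \<open>Lying in \<open>U\<close>, the dilate is a set on which \<open>f\<close>
      equals \<open>k\<close>; the factor \<open>1 + t\<close> is positive because
      \<open>\<epsilon>0 < 1\<close>.\<close>
    have "dilate (1 + t) \<Omega> \<subseteq> U" using t by (intro assms(16)) auto
    then have "additive_eigenvalue \<epsilon> (hamiltonian p f) (dilate (1 + t) \<Omega>)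
        = A + B * (1 + t) powr (- (p / (p - 1)))"
      using t \<open>\<epsilon>0 < 1\<close> k by (intro AB) auto
    then show ?thesis using assms(18)[OF t] by simp
  qed
  \<comment> \<open>Only the values of \<open>c\<close> on the open interval are known, and these
    determine its derivatives there.\<close>
  have "Ck_on m c ?I" for m
    using \<open>\<epsilon>0 < 1\<close>
    by (subst Ck_on_cong_open[OF open_greaterThanLessThan c_eq]) (auto intro!: Ck_on_affine_powr)
  then show ?thesis by (simp add: C_on_def)
qed

end
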